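(* For any maximization problem in the class Asymmetric Online Covering (AOC), the online algorithm $\textsc{Greedy}$, which accepts the current request if and only if adding it to the set of requests accepted so far keeps that set feasible, has online bounded ratio $1$. In particular, $\textsc{Greedy}$ has online bounded ratio $1$ (and hence is optimal with respect to online bounded analysis) for Online Independent Set in the vertex-arrival model, Unweighted Matching in the edge-arrival model, and Online Disjoint Path Allocation where requests are paths.
   Context: Online problem: requests arrive one at a time and each must be irrevocably handled before the next is revealed. An online accept-reject problem is one in which the algorithm must accept or reject each request. A maximization accept-reject problem is in AOC if, for the set $Y$ of accepted requests, the objective value is $|Y|$ if $Y$ is feasible and $-\infty$ otherwise, and every subset of a feasible set is feasible. Online bounded analysis: for a deterministic online algorithm $A$ of a maximization problem, $\textsc{Opt}_A$ denotes an offline algorithm that is optimal among offline algorithms whose solution on any input $I$ satisfies, for every prefix $I'$ of $I$, that the value of the solution restricted to $I'$ is at least $A(I')$. The online bounded ratio of $A$ is the supremum of all constants $c$ such that $A(I) \ge c\,\textsc{Opt}_A(I)$ for all inputs $I$ (so it is at most $1$). In Online Independent Set (vertex-arrival), vertices of a graph arrive with their edges to earlier vertices and the accepted set must be independent; in Unweighted Matching (edge-arrival), edges arrive and the accepted edges must form a matching; in Online Disjoint Path Allocation, requests are paths in a graph and accepted paths must be edge-disjoint. *)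

theory Defs
  imports "HOL-Library.Extended_Real" "HOL-Library.Disjoint_Sets"
begin

text \<open>
  A request sequence is a list. A set of accepted requests is given by the set of their
  positions, so that two equal requests in a sequence remain distinguishable. The fields
  \<open>feasible\<close> and \<open>profit\<close> are only meaningful for \<open>I \<in> inputs\<close> and \<open>Y \<subseteq> {..<length I}\<close>.
\<close>

record 'r accept_reject =
  inputs :: "'r list set"
  feasible :: "'r list \<Rightarrow> nat set \<Rightarrow> bool"
  profit :: "'r list \<Rightarrow> nat set \<Rightarrow> ereal"

text \<open>
  Feasibility is a property of the set of requests itself. Since it is also evaluated on
  prefixes, the second condition says that later requests do not influence it.
\<close>

definition online_accept_reject :: "'r accept_reject \<Rightarrow> bool" where
  "online_accept_reject P \<longleftrightarrow>
     (\<forall>I J. I @ J \<in> inputs P \<longrightarrow> I \<in> inputs P) \<and>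
     (\<forall>I J Y. I @ J \<in> inputs P \<and> Y \<subseteq> {..<length I} \<longrightarrow>
        (feasible P (I @ J) Y \<longleftrightarrow> feasible P I Y))"

definition AOC_max :: "'r accept_reject \<Rightarrow> bool" where
  "AOC_max P \<longleftrightarrow> online_accept_reject P \<and>
     (\<forall>I\<in>inputs P. \<forall>Y\<subseteq>{..<length I}.
        profit P I Y = (if feasible P I Y then ereal (real (card Y)) else -\<infinity>)) \<and>
     (\<forall>I\<in>inputs P. \<forall>Y\<subseteq>{..<length I}. \<forall>Z\<subseteq>Y. feasible P I Y \<longrightarrow> feasible P I Z)"

text \<open>
  A deterministic online algorithm decides, given the requests up to and including the current
  one, whether to accept the current one; its earlier decisions are determined by that prefix.
\<close>

type_synonym 'r online_alg = "'r list \<Rightarrow> bool"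

definition accepted :: "'r online_alg \<Rightarrow> 'r list \<Rightarrow> nat set" where
  "accepted A I = {i. i < length I \<and> A (take (Suc i) I)}"

text \<open>
  The set comprehension is the set of requests accepted before the current (last) one; see
  \<open>greedy_snoc\<close> below.
\<close>

context
  notes conj_cong [fundef_cong]
begin

function greedy :: "'r accept_reject \<Rightarrow> 'r online_alg" where
  "greedy P p \<longleftrightarrow> p \<noteq> [] \<and>
     feasible P p (insert (length p - 1) {i. i < length p - 1 \<and> greedy P (take (Suc i) p)})"
  by auto
termination
  by (relation "measure (\<lambda>(P, p). length p)") auto

end

declare greedy.simps [simp del]

lemma greedy_snoc:
  "greedy P (I @ [r]) \<longleftrightarrow> feasible P (I @ [r]) (insert (length I) (accepted (greedy P) I))"
proof -
  have "{i. i < length I \<and> greedy P (take (Suc i) (I @ [r]))} = accepted (greedy P) I"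
    by (auto simp: accepted_def)
  then show ?thesis
    by (subst greedy.simps) simp
qed

text \<open>An offline algorithm maps a whole input to the set of accepted requests.\<close>

type_synonym 'r offline_alg = "'r list \<Rightarrow> nat set"

definition offline_bounded :: "'r accept_reject \<Rightarrow> 'r online_alg \<Rightarrow> 'r offline_alg \<Rightarrow> bool" where
  "offline_bounded P A S \<longleftrightarrow>
     (\<forall>I\<in>inputs P. S I \<subseteq> {..<length I} \<and>
        (\<forall>k\<le>length I.
           profit P (take k I) (S I \<inter> {..<k}) \<ge> profit P (take k I) (accepted A (take k I))))"

definition is_Opt :: "'r accept_reject \<Rightarrow> 'r online_alg \<Rightarrow> 'r offline_alg \<Rightarrow> bool" where
  "is_Opt P A S \<longleftrightarrow> offline_bounded P A S \<and>
     (\<forall>T. offline_bounded P A T \<longrightarrow> (\<forall>I\<in>inputs P. profit P I (T I) \<le> profit P I (S I)))"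

definition Opt :: "'r accept_reject \<Rightarrow> 'r online_alg \<Rightarrow> 'r offline_alg" where
  "Opt P A = (SOME S. is_Opt P A S)"

lemma accepted_take: "accepted A (take k I) = accepted A I \<inter> {..<k}"
  by (auto simp: accepted_def)

lemma offline_bounded_accepted: "offline_bounded P A (accepted A)"
  by (auto simp: offline_bounded_def accepted_take) (auto simp: accepted_def)

lemma is_Opt_Opt: "is_Opt P A (Opt P A)"
proof -
  define B where "B I = {Y. Y \<subseteq> {..<length I} \<and> (\<forall>k\<le>length I.
     profit P (take k I) (Y \<inter> {..<k}) \<ge> profit P (take k I) (accepted A (take k I)))}" for I
  have fin: "finite (B I)" for I
    by (rule finite_subset[of _ "Pow {..<length I}"]) (auto simp: B_def)
  have ne: "accepted A I \<in> B I" for I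
    by (auto simp: B_def accepted_take) (auto simp: accepted_def)
  have "\<exists>Y\<in>B I. \<forall>Z\<in>B I. profit P I Z \<le> profit P I Y" for I
  proof -
    have "Max (profit P I ` B I) \<in> profit P I ` B I"
      using fin[of I] ne[of I] by (intro Max_in) auto
    then obtain Y where "Y \<in> B I" "profit P I Y = Max (profit P I ` B I)"
      by auto
    with fin[of I] show ?thesis
      by (intro bexI[of _ Y]) auto
  qed
  then obtain S where S: "\<And>I. S I \<in> B I" "\<And>I Z. Z \<in> B I \<Longrightarrow> profit P I Z \<le> profit P I (S I)"
    by metis
  have bnd: "offline_bounded P A T \<longleftrightarrow> (\<forall>I\<in>inputs P. T I \<in> B I)" for T
    by (auto simp: offline_bounded_def B_def)
  have "is_Opt P A S"
    unfolding is_Opt_def bnd using S by blast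
  then show ?thesis
    unfolding Opt_def by (rule someI[of "is_Opt P A"])
qed

text \<open>
  The ratio is at most \<open>1\<close> by convention. For AOC problems, taking the minimum only
  matters in the degenerate case that no input has
  positive optimal profit, where arbitrarily large constants would satisfy the inequality;
  see \<open>online_bounded_ratio_eq_SUP\<close>.
\<close>

definition bounded_consts :: "'r accept_reject \<Rightarrow> 'r online_alg \<Rightarrow> real set" where
  "bounded_consts P A =
     {c. \<forall>I\<in>inputs P. profit P I (accepted A I) \<ge> ereal c * profit P I (Opt P A I)}"

definition online_bounded_ratio :: "'r accept_reject \<Rightarrow> 'r online_alg \<Rightarrow> ereal" where
  "online_bounded_ratio P A = min 1 (SUP c\<in>bounded_consts P A. ereal c)"

lemma online_bounded_ratio_eq_SUP:
  assumes P: "AOC_max P" and I: "I \<in> inputs P" and pos: "profit P I (Opt P A I) > 0"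
  shows "online_bounded_ratio P A = (SUP c\<in>bounded_consts P A. ereal c)"
proof -
  let ?o = "profit P I (Opt P A I)"
  have sub: "Opt P A I \<subseteq> {..<length I}" and le: "profit P I (accepted A I) \<le> ?o"
    using is_Opt_Opt[of P A] offline_bounded_accepted[of P A] I
    by (auto simp: is_Opt_def offline_bounded_def)
  have "?o = (if feasible P I (Opt P A I) then ereal (real (card (Opt P A I))) else -\<infinity>)"
    using P I sub unfolding AOC_max_def by blast
  with pos obtain x where x: "?o = ereal x"
    by (cases "feasible P I (Opt P A I)") simp_all
  have "c \<le> 1" if c: "c \<in> bounded_consts P A" for c
  proof -
    have "ereal c * ?o \<le> ?o"
      using c I le unfolding bounded_consts_def by (blast intro: order_trans)
    with x pos show ?thesis
      by simp
  qed
  then have "(SUP c\<in>bounded_consts P A. ereal c) \<le> 1"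
    by (auto intro!: SUP_least)
  then show ?thesis
    unfolding online_bounded_ratio_def by (rule min_absorb2)
qed

definition optimal_online :: "'r accept_reject \<Rightarrow> 'r online_alg \<Rightarrow> bool" where
  "optimal_online P A \<longleftrightarrow> (\<forall>B. online_bounded_ratio P B \<le> online_bounded_ratio P A)"

definition max_cardinality ::
    "'r list set \<Rightarrow> ('r list \<Rightarrow> nat set \<Rightarrow> bool) \<Rightarrow> 'r accept_reject" where
  "max_cardinality ins feas = \<lparr>inputs = ins, feasible = feas,
     profit = (\<lambda>I Y. if feas I Y then ereal (real (card Y)) else -\<infinity>)\<rparr>"

text \<open>A request \<open>(v, N)\<close> is a new vertex \<open>v\<close> with the set \<open>N\<close> of its earlier neighbours.\<close>

definition revealed_edges :: "('v \<times> 'v set) list \<Rightarrow> 'v set set" where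
  "revealed_edges I = {{u, v} | u v N. (v, N) \<in> set I \<and> u \<in> N}"

definition independent_in :: "'v set set \<Rightarrow> 'v set \<Rightarrow> bool" where
  "independent_in E S \<longleftrightarrow> (\<forall>u\<in>S. \<forall>v\<in>S. {u, v} \<notin> E)"

definition online_independent_set :: "('v \<times> 'v set) accept_reject" where
  "online_independent_set = max_cardinality
     {I. distinct (map fst I) \<and> (\<forall>i<length I. snd (I ! i) \<subseteq> fst ` set (take i I))}
     (\<lambda>I Y. independent_in (revealed_edges I) ((\<lambda>i. fst (I ! i)) ` Y))"

definition unweighted_matching :: "'v set accept_reject" where
  "unweighted_matching = max_cardinality
     {I. distinct I \<and> (\<forall>e\<in>set I. card e = 2)}
     (\<lambda>I Y. disjoint_family_on (\<lambda>i. I ! i) Y)"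

definition simple_graph :: "'v set \<Rightarrow> 'v set set \<Rightarrow> bool" where
  "simple_graph V E \<longleftrightarrow> finite V \<and> (\<forall>e\<in>E. e \<subseteq> V \<and> card e = 2)"

definition path_edges :: "'v list \<Rightarrow> 'v set set" where
  "path_edges p = {{p ! i, p ! Suc i} | i. Suc i < length p}"

definition path_in :: "'v set \<Rightarrow> 'v set set \<Rightarrow> 'v list \<Rightarrow> bool" where
  "path_in V E p \<longleftrightarrow> p \<noteq> [] \<and> distinct p \<and> set p \<subseteq> V \<and> path_edges p \<subseteq> E"

definition disjoint_path_allocation :: "'v set \<Rightarrow> 'v set set \<Rightarrow> 'v list accept_reject" where
  "disjoint_path_allocation V E = max_cardinality
     {I. \<forall>p\<in>set I. path_in V E p}
     (\<lambda>I Y. disjoint_family_on (\<lambda>i. path_edges (I ! i)) Y)"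

end

theory Submission
  imports Defs
begin

text \<open>
  \<open>Opt_A\<close> is only compared with solutions that keep up with Greedy on every prefix, and such
  a solution must coincide with Greedy's: when Greedy accepts, the solution has to accept in order
  to keep up, and when Greedy rejects, accepting would make the solution infeasible.
\<close>

lemma AOC_max_take:
  assumes "AOC_max P" "I \<in> inputs P"
  shows "take k I \<in> inputs P"
  using assms append_take_drop_id[of k I]
  unfolding AOC_max_def online_accept_reject_def by metis

lemma AOC_max_feasible_append:
  assumes "AOC_max P" "I @ J \<in> inputs P" "Y \<subseteq> {..<length I}"
  shows "feasible P (I @ J) Y \<longleftrightarrow> feasible P I Y"
  using assms by (simp add: AOC_max_def online_accept_reject_def)

lemma AOC_max_profit:
  assumes "AOC_max P" "I \<in> inputs P" "Y \<subseteq> {..<length I}"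
  shows "profit P I Y = (if feasible P I Y then ereal (real (card Y)) else -\<infinity>)"
  using assms unfolding AOC_max_def by blast

lemma AOC_max_feasible_subset:
  assumes "AOC_max P" "I \<in> inputs P" "feasible P I Y" "Y \<subseteq> {..<length I}" "Z \<subseteq> Y"
  shows "feasible P I Z"
  using assms unfolding AOC_max_def by blast

lemma accepted_subset: "accepted A I \<subseteq> {..<length I}"
  by (auto simp: accepted_def)

text \<open>Decisions on earlier requests depend only on their own prefixes, so appending
  \<open>r\<close> cannot revise them.\<close>

lemma accepted_snoc:
  "accepted A (I @ [r]) =
     (if A (I @ [r]) then insert (length I) (accepted A I) else accepted A I)"
  by (auto simp: accepted_def less_Suc_eq)

text \<open>An acceptance keeps the set feasible because that is Greedy's test; after a rejection
  the old set stays feasible because later requests do not influence feasibility. The induction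
  starts from the empty set, which \<open>AOC_max\<close> alone does not make feasible.\<close>

lemma feasible_accepted_greedy:
  assumes P: "AOC_max P" and "I \<in> inputs P" and "feasible P I {}"
  shows "feasible P I (accepted (greedy P) I)"
  using assms(2,3)
proof (induction I rule: rev_induct)
  case Nil
  then show ?case by (simp add: accepted_def)
next
  case (snoc r I)
  have "I \<in> inputs P"
    using AOC_max_take[OF P snoc.prems(1), of "length I"] by simp
  moreover have "feasible P I {}"
    using AOC_max_feasible_append[OF P snoc.prems(1)] snoc.prems(2) by simp
  ultimately have "feasible P (I @ [r]) (accepted (greedy P) I)"
    using snoc.IH AOC_max_feasible_append[OF P snoc.prems(1) accepted_subset] by simp
  then show ?case
    by (simp add: accepted_snoc greedy_snoc)
qed

lemma bounded_solution_eq_greedy: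
  assumes P: "AOC_max P" and "I \<in> inputs P" and "feasible P I {}" and "Y \<subseteq> {..<length I}"
    and "\<And>k. k \<le> length I \<Longrightarrow>
      profit P (take k I) (Y \<inter> {..<k}) \<ge> profit P (take k I) (accepted (greedy P) (take k I))"
  shows "Y = accepted (greedy P) I"
  using assms(2-)
proof (induction I arbitrary: Y rule: rev_induct)
  case Nil
  then show ?case by (simp add: accepted_def)
next
  case (snoc r I)
  let ?n = "length I" and ?G = "accepted (greedy P) I"
  have I: "I \<in> inputs P"
    using AOC_max_take[OF P snoc.prems(1), of ?n] by simp
  have e: "feasible P I {}"
    using AOC_max_feasible_append[OF P snoc.prems(1)] snoc.prems(2) by simp
  \<comment> \<open>The lower bounds hold at every prefix, so those with \<open>k\<close> at most
    \<open>?n\<close> are exactly what the induction hypothesis needs for the part of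
    \<open>Y\<close> before the last request.\<close>
  have "Y \<inter> {..<?n} = ?G"
  proof (rule snoc.IH[OF I e])
    fix k assume k: "k \<le> length I"
    then have "Y \<inter> {..<?n} \<inter> {..<k} = Y \<inter> {..<k}" by auto
    with k snoc.prems(4)[of k]
    show "profit P (take k I) (accepted (greedy P) (take k I))
        \<le> profit P (take k I) (Y \<inter> {..<?n} \<inter> {..<k})" by simp
  qed simp
  moreover have "Y \<subseteq> insert ?n {..<?n}"
    using snoc.prems(3) by (simp add: lessThan_Suc)
  \<comment> \<open>Only the decision on the last request, at position \<open>?n\<close>, is still
    open.\<close>
  ultimately have acc: "?n \<in> Y \<Longrightarrow> Y = insert ?n ?G" and rej: "?n \<notin> Y \<Longrightarrow> Y = ?G"
    by auto
  have nG: "?n \<notin> ?G" and fin: "finite ?G"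
    using accepted_subset[of "greedy P" I] by (auto intro: finite_subset[of _ "{..<?n}"])
  have "Y \<inter> {..<Suc ?n} = Y" using snoc.prems(3) by auto
  then have "profit P (I @ [r]) (accepted (greedy P) (I @ [r])) \<le> profit P (I @ [r]) Y"
    using snoc.prems(4)[of "Suc ?n"] by simp
  moreover have "feasible P (I @ [r]) (accepted (greedy P) (I @ [r]))"
    by (rule feasible_accepted_greedy[OF P snoc.prems(1,2)])
  \<comment> \<open>Greedy's profit is finite, so a profit at least as large cannot be -\<infinity>:
    this forces \<open>Y\<close> to be feasible and turns the comparison into one of
    cardinalities.\<close>
  ultimately have f: "feasible P (I @ [r]) Y"
    and c: "card (accepted (greedy P) (I @ [r])) \<le> card Y"
    using AOC_max_profit[OF P snoc.prems(1) snoc.prems(3)]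
      AOC_max_profit[OF P snoc.prems(1) accepted_subset]
    by (auto split: if_splits)
  have "?n \<in> Y \<longleftrightarrow> greedy P (I @ [r])"
  proof
    assume "?n \<in> Y"
    \<comment> \<open>Here \<open>Y\<close> is the very set whose feasibility Greedy tests.\<close>
    with acc f show "greedy P (I @ [r])" by (metis greedy_snoc)
  next
    assume "greedy P (I @ [r])"
    \<comment> \<open>Greedy now has one element more than \<open>?G\<close>, so
      \<open>Y = ?G\<close> would fall behind.\<close>
    with c nG fin have "card ?G < card Y" by (simp add: accepted_snoc)
    with rej show "?n \<in> Y" by (metis less_irrefl)
  qed
  with acc rej show ?case by (metis accepted_snoc)
qed

lemma online_bounded_ratio_le_1: "online_bounded_ratio P A \<le> 1"
  by (simp add: online_bounded_ratio_def)

lemma online_bounded_ratio_greedy: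
  assumes P: "AOC_max P"
  shows "online_bounded_ratio P (greedy P) = 1"
proof -
  \<comment> \<open>This is the defining inequality of the ratio for the constant 1.\<close>
  have "profit P I (Opt P (greedy P) I) \<le> profit P I (accepted (greedy P) I)"
    if I: "I \<in> inputs P" for I
  proof -
    have sub: "Opt P (greedy P) I \<subseteq> {..<length I}"
      and bnd: "\<And>k. k \<le> length I \<Longrightarrow> profit P (take k I) (accepted (greedy P) (take k I))
        \<le> profit P (take k I) (Opt P (greedy P) I \<inter> {..<k})"
      using is_Opt_Opt[of P "greedy P"] I by (auto simp: is_Opt_def offline_bounded_def)
    show ?thesis
    proof (cases "feasible P I {}")
      case True
      from bounded_solution_eq_greedy[OF P I True sub bnd] show ?thesis by simp
    next
      case False
      \<comment> \<open>If the empty set is infeasible, downward closure leaves no feasible set, so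
        the optimum is -\<infinity> and the inequality is trivial.\<close>
      then have "\<not> feasible P I (Opt P (greedy P) I)"
        using AOC_max_feasible_subset[OF P I _ sub] by blast
      then show ?thesis using AOC_max_profit[OF P I sub] by simp
    qed
  qed
  then have "1 \<in> bounded_consts P (greedy P)"
    by (simp add: bounded_consts_def flip: one_ereal_def)
  then have "ereal 1 \<le> (SUP c\<in>bounded_consts P (greedy P). ereal c)"
    by (rule SUP_upper)
  then show ?thesis
    by (simp add: online_bounded_ratio_def min_absorb1 flip: one_ereal_def)
qed

text \<open>Greedy attains the cap 1 that bounds every ratio.\<close>

lemma optimal_online_greedy: "AOC_max P \<Longrightarrow> optimal_online P (greedy P)"
  by (simp add: optimal_online_def online_bounded_ratio_greedy online_bounded_ratio_le_1)

text \<open>Reduces each concrete problem to three facts about its inputs and its feasibility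
  predicate; the profit has the required form by construction.\<close>

lemma AOC_max_max_cardinality:
  assumes "\<And>I J. I @ J \<in> ins \<Longrightarrow> I \<in> ins"
    and "\<And>I J Y. I @ J \<in> ins \<Longrightarrow> Y \<subseteq> {..<length I} \<Longrightarrow> feas (I @ J) Y \<longleftrightarrow> feas I Y"
    and "\<And>I Y Z. feas I Y \<Longrightarrow> Z \<subseteq> Y \<Longrightarrow> feas I Z"
  shows "AOC_max (max_cardinality ins feas)"
  unfolding AOC_max_def online_accept_reject_def max_cardinality_def
  using assms by simp

text \<open>Serves matching with \<open>f\<close> the identity and path allocation with
  \<open>f\<close> equal to \<open>path_edges\<close>.\<close>

lemma disjoint_family_on_nth_append:
  assumes "Y \<subseteq> {..<length I}"
  shows "disjoint_family_on (\<lambda>i. f ((I @ J) ! i)) Y \<longleftrightarrow> disjoint_family_on (\<lambda>i. f (I ! i)) Y"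
proof -
  have "(I @ J) ! i = I ! i" if "i \<in> Y" for i
    using that assms by (auto simp: nth_append)
  then show ?thesis by (simp add: disjoint_family_on_def)
qed

lemma independent_in_subset: "independent_in E S \<Longrightarrow> T \<subseteq> S \<Longrightarrow> independent_in E T"
  by (auto simp: independent_in_def)

text \<open>Each later edge has a new vertex as an endpoint, so it cannot join two earlier vertices.\<close>

lemma independent_in_revealed_edges_append:
  assumes "distinct (map fst (I @ J))" and "S \<subseteq> fst ` set I"
  shows "independent_in (revealed_edges (I @ J)) S \<longleftrightarrow> independent_in (revealed_edges I) S"
proof -
  have "{u, v} \<in> revealed_edges (I @ J) \<longleftrightarrow> {u, v} \<in> revealed_edges I"
    if "u \<in> S" "v \<in> S" for u v
  proof
    assume "{u, v} \<in> revealed_edges (I @ J)"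
    then obtain a b N where e: "{u, v} = {a, b}" "(b, N) \<in> set (I @ J)" "a \<in> N"
      unfolding revealed_edges_def by blast
    \<comment> \<open>The later endpoint \<open>b\<close> is one of \<open>u\<close> and
      \<open>v\<close>, hence a vertex of \<open>I\<close>. Vertices arrive only once, so the
      request \<open>(b, N)\<close> must itself lie in \<open>I\<close>.\<close>
    then have "b \<in> fst ` set I" using that assms(2) by (auto simp: doubleton_eq_iff)
    with e(2) assms(1) have "(b, N) \<in> set I" by force
    with e(1,3) show "{u, v} \<in> revealed_edges I" unfolding revealed_edges_def by blast
  next
    assume "{u, v} \<in> revealed_edges I"
    then show "{u, v} \<in> revealed_edges (I @ J)" unfolding revealed_edges_def by fastforce
  qed
  then show ?thesis by (simp add: independent_in_def)
qed

lemma AOC_max_online_independent_set: "AOC_max online_independent_set"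
  unfolding online_independent_set_def
proof (rule AOC_max_max_cardinality)
  fix I J :: "('a \<times> 'a set) list"
  assume IJ: "I @ J \<in> {I. distinct (map fst I) \<and>
    (\<forall>i<length I. snd (I ! i) \<subseteq> fst ` set (take i I))}"
  have "snd (I ! i) \<subseteq> fst ` set (take i I)" if "i < length I" for i
  proof -
    from IJ that have "snd ((I @ J) ! i) \<subseteq> fst ` set (take i (I @ J))"
      by (metis (no_types, lifting) mem_Collect_eq length_append trans_less_add1)
    with that show ?thesis by (simp add: nth_append)
  qed
  with IJ show "I \<in> {I. distinct (map fst I) \<and>
      (\<forall>i<length I. snd (I ! i) \<subseteq> fst ` set (take i I))}" by simp
  fix Y assume Y: "Y \<subseteq> {..<length I}"
  then have "(\<lambda>i. fst ((I @ J) ! i)) ` Y = (\<lambda>i. fst (I ! i)) ` Y"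
    by (intro image_cong) (auto simp: nth_append)
  moreover have "(\<lambda>i. fst (I ! i)) ` Y \<subseteq> fst ` set I"
    using Y by auto
  ultimately show "independent_in (revealed_edges (I @ J)) ((\<lambda>i. fst ((I @ J) ! i)) ` Y) \<longleftrightarrow>
      independent_in (revealed_edges I) ((\<lambda>i. fst (I ! i)) ` Y)"
    using IJ independent_in_revealed_edges_append[of I J] by simp
qed (rule independent_in_subset[OF _ image_mono])

lemma AOC_max_unweighted_matching: "AOC_max unweighted_matching"
  unfolding unweighted_matching_def
  by (rule AOC_max_max_cardinality)
    (auto simp: disjoint_family_on_nth_append[of _ _ "\<lambda>x. x"], rule disjoint_family_on_mono)

lemma AOC_max_disjoint_path_allocation: "AOC_max (disjoint_path_allocation V E)"
  unfolding disjoint_path_allocation_def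
  by (rule AOC_max_max_cardinality)
    (auto simp: disjoint_family_on_nth_append, rule disjoint_family_on_mono)

theorem theorem1:
  "(\<forall>P :: 'r accept_reject. AOC_max P \<longrightarrow> online_bounded_ratio P (greedy P) = 1) \<and>
   (let P = (online_independent_set :: ('u \<times> 'u set) accept_reject) in
      AOC_max P \<and> online_bounded_ratio P (greedy P) = 1 \<and> optimal_online P (greedy P)) \<and>
   (let P = (unweighted_matching :: 'v set accept_reject) in
      AOC_max P \<and> online_bounded_ratio P (greedy P) = 1 \<and> optimal_online P (greedy P)) \<and>
   (\<forall>(V :: 'w set) E. simple_graph V E \<longrightarrow>
      (let P = disjoint_path_allocation V E in
         AOC_max P \<and> online_bounded_ratio P (greedy P) = 1 \<and> optimal_online P (greedy P)))"
  by (simp add: Let_def online_bounded_ratio_greedy optimal_online_greedy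
      AOC_max_online_independent_set AOC_max_unweighted_matching AOC_max_disjoint_path_allocation)

end
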